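(* For every integer $n \geq 32$, $$\frac{1}{105}\Bigl(\frac{\pi}{n}\Bigr)^6 < \frac{\Pi(n)-\pi}{\pi} < \frac{1}{104\frac{7}{10}}\Bigl(\frac{\pi}{n}\Bigr)^6,$$ where $104\frac{7}{10} = 104.7$ (a mixed number). Moreover, the lower-bound constant $\frac{1}{105}$ is best possible: it cannot be replaced by a larger one, i.e. for every real $c > \frac{1}{105}$ the inequality $c\,(\pi/n)^6 < \frac{\Pi(n)-\pi}{\pi}$ does not hold for all integers $n \geq 32$.
   Context: For a positive integer $n \geq 3$, define the Chakrabarti--Hudson approximation to $\pi$ by $$\Pi(n) := \frac{n}{30}\left\{32\sin\Bigl(\frac{\pi}{n}\Bigr) + 4\tan\Bigl(\frac{\pi}{n}\Bigr) - 3\sin\Bigl(\frac{2\pi}{n}\Bigr)\right\}.$$ *)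

theory Defs
  imports Complex_Main
begin

text \<open>
  The Chakrabarti--Hudson approximation to \<open>\<pi>\<close>. It is meant for \<open>n \<ge> 3\<close>; for \<open>n < 3\<close> the
  value is an artefact of totality (for instance, \<open>tan (pi / 2) = 0\<close>).
\<close>
definition CH_approx :: "nat \<Rightarrow> real" where
  "CH_approx n = real n / 30 *
     (32 * sin (pi / real n) + 4 * tan (pi / real n) - 3 * sin (2 * pi / real n))"

end

theory Submission
  imports Defs "HOL-Analysis.Complex_Transcendental"
begin

text \<open>
  With \<open>x = \<pi> / n\<close> the relative error is \<open>(32 sin x + 4 tan x - 3 sin (2 x)) / (30 x) - 1\<close>, and
  the numerator has the expansion \<open>30 x + (2/7) x^7 + (1/12) x^9 + \<dots>\<close>. The upper bound of the
  error by \<open>x^6/105 + x^8/355\<close> yields both the constant \<open>1/104.7\<close> for \<open>x \<le> \<pi>/32\<close> and, as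
  \<open>x\<close> tends to 0, the optimality of \<open>1/105\<close>.
\<close>

text \<open>Keeping the \<open>x^9\<close> term leaves an error of order \<open>x^11\<close>,
  negligible against the \<open>x^9\<close> margins below.\<close>

lemma sin_taylor_11:
  fixes x :: real
  shows "\<bar>sin x - (x - x^3/6 + x^5/120 - x^7/5040 + x^9/362880)\<bar> \<le> \<bar>x\<bar>^11 / 39916800"
proof -
  have "(\<Sum>m<11. sin_coeff m * x ^ m) = x - x^3/6 + x^5/120 - x^7/5040 + x^9/362880"
    by (simp add: sin_coeff_def lessThan_nat_numeral fact_numeral)
  moreover have "inverse (fact 11) = (1 / 39916800 :: real)"
    by (simp add: fact_numeral)
  ultimately show ?thesis
    using Maclaurin_sin_bound[of x 11] by (metis mult.commute times_divide_eq_right mult.right_neutral)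
qed

lemma cos_taylor_10:
  fixes x :: real
  shows "\<bar>cos x - (1 - x^2/2 + x^4/24 - x^6/720 + x^8/40320)\<bar> \<le> x^10 / 3628800"
proof -
  have sum: "(\<Sum>m<10. cos_coeff m * x ^ m) = 1 - x^2/2 + x^4/24 - x^6/720 + x^8/40320"
    by (simp add: cos_coeff_def lessThan_nat_numeral fact_numeral)
  obtain t where "cos x = (\<Sum>m<10. cos_coeff m * x ^ m)
      + cos (t + 1/2 * real 10 * pi) / fact 10 * x ^ 10"
    using Maclaurin_cos_expansion[of x 10] by blast
  then have "cos x - (1 - x^2/2 + x^4/24 - x^6/720 + x^8/40320)
      = cos (t + 1/2 * real 10 * pi) * (x ^ 10 / 3628800)"
    unfolding sum by (simp add: fact_numeral)
  moreover have "\<bar>cos u * (x ^ 10 / 3628800)\<bar> \<le> x ^ 10 / 3628800" for u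
    using mult_right_mono[OF abs_cos_le_one[of u], of "x^10 / 3628800"]
    by (simp add: abs_mult)
  ultimately show ?thesis by metis
qed

text \<open>Serves to make polynomials in \<open>y\<close> linear: each power becomes an atom
  between 0 and \<open>y\<close>.\<close>

lemma power_le_base:
  fixes y :: real
  assumes "0 \<le> y" "y \<le> 1" "0 < k"
  shows "0 \<le> y ^ k \<and> y ^ k \<le> y"
  using assms power_decreasing[of 1 k y] by simp

text \<open>The exact ninth Taylor coefficient of \<open>tan\<close> is \<open>62/2835\<close>, which lies between \<open>1/50\<close> and
  \<open>221/10000\<close>.\<close>

lemma tan_gt_poly:
  fixes x :: real
  assumes "0 < x" "x \<le> 1/10"
  shows "x + x^3/3 + 2*x^5/15 + 17*x^7/315 + x^9/50 < tan x"
proof -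
  let ?T = "x + x^3/3 + 2*x^5/15 + 17*x^7/315 + x^9/50"
  \<comment> \<open>The remainder signs make \<open>?C\<close> an upper bound of
    \<open>cos x\<close> and \<open>?S\<close> a lower bound of \<open>sin x\<close>, so
    \<open>?T * ?C < ?S\<close> suffices.\<close>
  let ?C = "1 - x^2/2 + x^4/24 - x^6/720 + x^8/40320 + x^10/3628800"
  let ?S = "x - x^3/6 + x^5/120 - x^7/5040 + x^9/362880 - x^11/39916800"
  have "cos x > 0"
    using assms pi_gt3 by (intro cos_gt_zero_pi) auto
  have C: "cos x \<le> ?C"
    using cos_taylor_10[of x] by (simp only: abs_le_iff) linarith
  define y where "y = x^2"
  have y: "0 < y" "y \<le> 1/100"
    using assms power_mono[of x "1/10" 2] by (auto simp: y_def power2_eq_square)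
  \<comment> \<open>\<open>?T\<close> agrees with the series of \<open>tan\<close> through
    \<open>x^7\<close>, so all lower terms cancel. The leading coefficient is 62/2835 - 1/50 =
    53/28350.\<close>
  have P: "?S - ?T * ?C = x^9 * (53/28350 + 17581/2217600 * y - 8293/10886400 * y^2
      + 503/19051200 * y^3 - 73/142884000 * y^4 - 1/181440000 * y^5)"
    by (simp add: y_def field_simps power_numeral_reduce)
  have "0 < 53/28350 + 17581/2217600 * y - 8293/10886400 * y^2
      + 503/19051200 * y^3 - 73/142884000 * y^4 - 1/181440000 * y^5"
    using y power_le_base[of y 2] power_le_base[of y 3] power_le_base[of y 4]
      power_le_base[of y 5] by linarith
  then have "?T * ?C < ?S"
    using P assms by (smt (verit) mult_pos_pos zero_less_power)
  moreover have "?S \<le> sin x"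
    using sin_taylor_11[of x] assms(1) by (simp only: abs_le_iff abs_of_pos) linarith
  moreover have "?T * cos x \<le> ?T * ?C"
    using C assms by (intro mult_left_mono) auto
  ultimately show ?thesis
    using \<open>cos x > 0\<close> by (simp add: tan_def pos_less_divide_eq)
qed

lemma tan_less_poly:
  fixes x :: real
  assumes "0 < x" "x \<le> 1/10"
  shows "tan x < x + x^3/3 + 2*x^5/15 + 17*x^7/315 + 221*x^9/10000"
proof -
  let ?T = "x + x^3/3 + 2*x^5/15 + 17*x^7/315 + 221*x^9/10000"
  \<comment> \<open>Both remainder signs are now reversed: \<open>?C\<close> bounds
    \<open>cos x\<close> from below, \<open>?S\<close> bounds \<open>sin x\<close> from
    above.\<close>
  let ?C = "1 - x^2/2 + x^4/24 - x^6/720 + x^8/40320 - x^10/3628800"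
  let ?S = "x - x^3/6 + x^5/120 - x^7/5040 + x^9/362880 + x^11/39916800"
  have "cos x > 0"
    using assms pi_gt3 by (intro cos_gt_zero_pi) auto
  have C: "?C \<le> cos x"
    using cos_taylor_10[of x] by (simp only: abs_le_iff) linarith
  define y where "y = x^2"
  have y: "0 < y" "y \<le> 1/100"
    using assms power_mono[of x "1/10" 2] by (auto simp: y_def power2_eq_square)
  \<comment> \<open>Here the leading coefficient is 221/10000 - 62/2835 = 1307/5670000; it dominates
    the linear term because \<open>y\<close> is at most 1/100.\<close>
  have P: "?T * ?C - ?S = x^9 * (1307/5670000 - 1493311/166320000 * y + 231089/272160000 * y^2
      - 279983/9525600000 * y^3 + 121907/228614400000 * y^4 - 221/36288000000 * y^5)"
    by (simp add: y_def field_simps power_numeral_reduce)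
  have "0 < 1307/5670000 - 1493311/166320000 * y + 231089/272160000 * y^2
      - 279983/9525600000 * y^3 + 121907/228614400000 * y^4 - 221/36288000000 * y^5"
    using y power_le_base[of y 2] power_le_base[of y 3] power_le_base[of y 4]
      power_le_base[of y 5] by linarith
  then have "?S < ?T * ?C"
    using P assms by (smt (verit) mult_pos_pos zero_less_power)
  moreover have "sin x \<le> ?S"
    using sin_taylor_11[of x] assms(1) by (simp only: abs_le_iff abs_of_pos) linarith
  moreover have "?T * ?C \<le> ?T * cos x"
    using C assms by (intro mult_left_mono) auto
  ultimately show ?thesis
    using \<open>cos x > 0\<close> by (simp add: tan_def pos_divide_less_eq)
qed

text \<open>The weights 32, 4, -3 cancel the \<open>x^3\<close> and \<open>x^5\<close> terms and
  leave 2/7 at \<open>x^7\<close>. The constant 6/71 = 30/355 is slightly above the true coefficient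
  1/12 of \<open>x^9\<close>.\<close>

lemma sin_tan_combination_bounds:
  fixes x :: real
  assumes "0 < x" "x \<le> 1/10"
  shows "30*x + 2/7*x^7 < 32 * sin x + 4 * tan x - 3 * sin (2*x)"
    and "32 * sin x + 4 * tan x - 3 * sin (2*x) < 30*x + 2/7*x^7 + 6/71*x^9"
proof -
  have x9: "x^9 > 0" using assms by simp
  have "x^11 = x^9 * x^2" by (simp flip: power_add)
  moreover have "x^2 \<le> 1/100"
    using assms power_mono[of x "1/10" 2] by (simp add: power2_eq_square)
  ultimately have x11: "x^11 \<le> x^9 / 100"
    using mult_left_mono[of "x^2" "1/100" "x^9"] x9 by simp
  note bounds = sin_taylor_11[of x, unfolded abs_le_iff] sin_taylor_11[of "2*x", unfolded abs_le_iff]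
  have eq: "\<bar>x\<bar> = x" "\<bar>2*x\<bar> = 2*x" using assms by auto
  \<comment> \<open>Expanding the powers of \<open>2*x\<close> leaves only monomials in
    \<open>x\<close>, so the estimates combine linearly.\<close>
  note bounds' = bounds[unfolded eq power_mult_distrib, simplified]
  show "30*x + 2/7*x^7 < 32 * sin x + 4 * tan x - 3 * sin (2*x)"
    using bounds' tan_gt_poly[OF assms] x9 x11 by linarith
  show "32 * sin x + 4 * tan x - 3 * sin (2*x) < 30*x + 2/7*x^7 + 6/71*x^9"
    using bounds' tan_less_poly[OF assms] x9 x11 by linarith
qed

lemma CH_approx_relative_error_bounds:
  assumes "n \<ge> 32"
  defines "x \<equiv> pi / real n"
  shows "x^6/105 < (CH_approx n - pi) / pi"
    and "(CH_approx n - pi) / pi < x^6/105 + x^8/355"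
proof -
  let ?f = "32 * sin x + 4 * tan x - 3 * sin (2*x)"
  have x0: "0 < x" using assms by simp
  have "pi \<le> 16/5" using pi_approx by simp
  then have x1: "x \<le> 1/10"
    using assms by (simp add: x_def divide_le_eq)
  \<comment> \<open>As \<open>n\<close> is \<open>pi / x\<close>, the prefactor
    \<open>n / (30 * pi)\<close> equals \<open>1 / (30*x)\<close>.\<close>
  have "(CH_approx n - pi) / pi = (?f - 30*x) / (30*x)"
    using assms by (simp add: CH_approx_def x_def field_simps)
  moreover have "(2/7*x^7) / (30*x) = x^6/105" "(2/7*x^7 + 6/71*x^9) / (30*x) = x^6/105 + x^8/355"
    using x0 by (simp_all add: field_simps eval_nat_numeral)
  moreover have "(2/7*x^7) / (30*x) < (?f - 30*x) / (30*x)"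
    using sin_tan_combination_bounds(1)[OF x0 x1] x0 by (intro divide_strict_right_mono) linarith+
  moreover have "(?f - 30*x) / (30*x) < (2/7*x^7 + 6/71*x^9) / (30*x)"
    using sin_tan_combination_bounds(2)[OF x0 x1] x0 by (intro divide_strict_right_mono) linarith+
  ultimately show "x^6/105 < (CH_approx n - pi) / pi"
    and "(CH_approx n - pi) / pi < x^6/105 + x^8/355"
    by (simp_all only:)
qed

theorem theorem1:
  shows "(\<forall>n::nat. n \<ge> 32 \<longrightarrow>
            1 / 105 * (pi / real n) ^ 6 < (CH_approx n - pi) / pi \<and>
            (CH_approx n - pi) / pi < 1 / (104 + 7 / 10) * (pi / real n) ^ 6) \<and>
         (\<forall>c::real. c > 1 / 105 \<longrightarrow>
            \<not> (\<forall>n::nat. n \<ge> 32 \<longrightarrow> c * (pi / real n) ^ 6 < (CH_approx n - pi) / pi))"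
proof (intro conjI allI impI notI)
  fix n :: nat
  assume n: "n \<ge> 32"
  show "1 / 105 * (pi / real n) ^ 6 < (CH_approx n - pi) / pi"
    using CH_approx_relative_error_bounds(1)[OF n] by simp
  let ?x = "pi / real n"
  \<comment> \<open>\<open>pi / 32\<close> is about 0.09817. The cruder bound 1/10 would not do:
    1/105 + 1/35500 exceeds 1/104.7.\<close>
  have "?x \<le> 0.0982"
    using n pi_approx by (simp add: divide_le_eq)
  then have "?x^2 \<le> 0.0982^2"
    using n by (intro power_mono) auto
  then have "1/105 + ?x^2/355 \<le> 1 / (104 + 7/10)"
    by (simp add: power2_eq_square)
  then have "(1/105 + ?x^2/355) * ?x^6 \<le> 1 / (104 + 7/10) * ?x^6"
    by (intro mult_right_mono) auto
  moreover have "(1/105 + ?x^2/355) * ?x^6 = ?x^6/105 + ?x^8/355"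
    by (simp add: distrib_right flip: power_add)
  ultimately show "(CH_approx n - pi) / pi < 1 / (104 + 7 / 10) * ?x ^ 6"
    using CH_approx_relative_error_bounds(2)[OF n] by (simp only: less_le_trans)
next
  fix c :: real
  assume c: "c > 1 / 105"
    and all: "\<forall>n::nat. n \<ge> 32 \<longrightarrow> c * (pi / real n) ^ 6 < (CH_approx n - pi) / pi"
  \<comment> \<open>The upper bound of the error, divided by \<open>(pi / n)^6\<close>, tends to
    1/105 and so eventually falls below \<open>c\<close>.\<close>
  have "(\<lambda>n. 1/105 + (pi / real n)^2/355) \<longlonglongrightarrow> 1/105 + 0^2/355"
    by (intro tendsto_intros lim_const_over_n) auto
  then have "\<forall>\<^sub>F n in sequentially. 1/105 + (pi / real n)^2/355 < c"
    using c by (intro order_tendstoD(2)) auto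
  moreover have "\<forall>\<^sub>F n in sequentially. n \<ge> (32::nat)"
    by (rule eventually_ge_at_top)
  ultimately have "\<forall>\<^sub>F n in sequentially. 1/105 + (pi / real n)^2/355 < c \<and> n \<ge> 32"
    by (rule eventually_conj)
  then obtain n :: nat where n: "1/105 + (pi / real n)^2/355 < c" "n \<ge> 32"
    using eventually_happens'[OF sequentially_bot] by blast
  let ?x = "pi / real n"
  have "(1/105 + ?x^2/355) * ?x^6 \<le> c * ?x^6"
    using n by (intro mult_right_mono) auto
  moreover have "(1/105 + ?x^2/355) * ?x^6 = ?x^6/105 + ?x^8/355"
    by (simp add: distrib_right flip: power_add)
  ultimately have "(CH_approx n - pi) / pi < c * ?x^6"
    using CH_approx_relative_error_bounds(2)[OF n(2)] by linarith
  moreover have "c * ?x^6 < (CH_approx n - pi) / pi"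
    using all n(2) by blast
  ultimately show False
    by (rule less_asym)
qed

end
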